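(* Let $T,S\in \mathcal{B}_A(\mathcal{H})$. Then $$\frac{\sqrt{2}}{2}\max\left\{\omega_A(T+S),\omega_A(T-S)\right\}\leq\omega_{A,\mathrm{e}}(T,S) \leq \frac{\sqrt{2}}{2}\sqrt{\omega_A^2(T+S)+\omega_A^2(T-S)}.$$ Moreover, the constant $\frac{\sqrt{2}}{2}$ is sharp in both inequalities: if $c>0$ is such that $c\max\{\omega_A(T+S),\omega_A(T-S)\}\leq\omega_{A,\mathrm{e}}(T,S)$ for all $T,S\in\mathcal{B}_A(\mathcal{H})$, then $c\leq\frac{\sqrt2}{2}$; and if $C>0$ is such that $\omega_{A,\mathrm{e}}(T,S)\leq C\sqrt{\omega_A^2(T+S)+\omega_A^2(T-S)}$ for all $T,S\in\mathcal{B}_A(\mathcal{H})$, then $C\geq\frac{\sqrt2}{2}$.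
   Context: $\mathcal{H}$ is a complex Hilbert space with inner product $\langle\cdot\mid\cdot\rangle$, $\mathcal{B}(\mathcal{H})$ is the algebra of bounded linear operators on $\mathcal{H}$, and $A\in\mathcal{B}(\mathcal{H})$ is a fixed nonzero positive (semidefinite) operator. Put $\langle x\mid y\rangle_A=\langle Ax\mid y\rangle$ and $\|x\|_A=\langle x\mid x\rangle_A^{1/2}$. $\mathcal{B}_A(\mathcal{H})=\{T\in\mathcal{B}(\mathcal{H}) : \mathcal{R}(T^*A)\subseteq\mathcal{R}(A)\}$, where $\mathcal{R}$ denotes range (equivalently, $T$ admits some $X\in\mathcal{B}(\mathcal{H})$ with $\langle Tx\mid y\rangle_A=\langle x\mid Xy\rangle_A$ for all $x,y$). For $T,S\in\mathcal{B}_A(\mathcal{H})$: $\omega_A(T)=\sup\{|\langle Tx\mid x\rangle_A| : \|x\|_A=1\}$ and $\omega_{A,\mathrm{e}}(T,S)=\sup\{(|\langle Tx\mid x\rangle_A|^2+|\langle Sx\mid x\rangle_A|^2)^{1/2} : \|x\|_A=1\}$; both are finite. *)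

theory Defs
  imports "HOL-Analysis.Analysis"
begin

class complex_vector = real_vector +
  fixes scaleC :: "complex \<Rightarrow> 'a \<Rightarrow> 'a"  (infixr "*\<^sub>C" 75)
  assumes scaleC_add_right: "c *\<^sub>C (x + y) = c *\<^sub>C x + c *\<^sub>C y"
    and scaleC_add_left: "(c + d) *\<^sub>C x = c *\<^sub>C x + d *\<^sub>C x"
    and scaleC_scaleC: "c *\<^sub>C d *\<^sub>C x = (c * d) *\<^sub>C x"
    and scaleC_one: "1 *\<^sub>C x = x"
    and scaleR_scaleC: "r *\<^sub>R x = complex_of_real r *\<^sub>C x"

text \<open>The inner product is linear in its first and conjugate-linear in its second argument.\<close>

class complex_inner = complex_vector + real_normed_vector +
  fixes cinner :: "'a \<Rightarrow> 'a \<Rightarrow> complex"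
  assumes cinner_commute: "cinner x y = cnj (cinner y x)"
    and cinner_add_left: "cinner (x + y) z = cinner x z + cinner y z"
    and cinner_scaleC_left: "cinner (c *\<^sub>C x) y = c * cinner x y"
    and cinner_self_nonneg: "cinner x x \<in> \<real>\<^sub>\<ge>\<^sub>0"
    and cinner_self_eq_zero_iff: "cinner x x = 0 \<longleftrightarrow> x = 0"
    and norm_eq_sqrt_cinner: "norm x = sqrt (Re (cinner x x))"

class complex_hilbert_space = complex_inner + complete_space

instantiation complex :: complex_hilbert_space
begin

definition scaleC_complex :: "complex \<Rightarrow> complex \<Rightarrow> complex"
  where "scaleC_complex c x = c * x"

definition cinner_complex :: "complex \<Rightarrow> complex \<Rightarrow> complex"
  where "cinner_complex x y = x * cnj y"

instance
proof
  fix x :: complex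
  show "cinner x x \<in> \<real>\<^sub>\<ge>\<^sub>0"
    by (simp add: cinner_complex_def complex_nonneg_Reals_iff)
  show "norm x = sqrt (Re (cinner x x))"
    by (simp add: cinner_complex_def cmod_def power2_eq_square)
qed (simp_all add: scaleC_complex_def cinner_complex_def algebra_simps scaleR_conv_of_real)

end

definition bounded_clinear :: "('a::complex_inner \<Rightarrow> 'a) \<Rightarrow> bool"
  where "bounded_clinear T \<longleftrightarrow> bounded_linear T \<and> (\<forall>c x. T (c *\<^sub>C x) = c *\<^sub>C T x)"

text \<open>For a bounded operator on a Hilbert space the adjoint exists (Riesz representation)
  and is unique, so the description below is proper for the operators considered here.\<close>

definition cadjoint :: "('a::complex_hilbert_space \<Rightarrow> 'a) \<Rightarrow> 'a \<Rightarrow> 'a"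
  where "cadjoint T = (THE S. \<forall>x y. cinner (T x) y = cinner x (S y))"

definition positive_operator :: "('a::complex_hilbert_space \<Rightarrow> 'a) \<Rightarrow> bool"
  where "positive_operator A \<longleftrightarrow> bounded_clinear A \<and> (\<forall>x. cinner (A x) x \<in> \<real>\<^sub>\<ge>\<^sub>0)"

definition A_inner :: "('a::complex_hilbert_space \<Rightarrow> 'a) \<Rightarrow> 'a \<Rightarrow> 'a \<Rightarrow> complex"
  where "A_inner A x y = cinner (A x) y"

definition A_norm :: "('a::complex_hilbert_space \<Rightarrow> 'a) \<Rightarrow> 'a \<Rightarrow> real"
  where "A_norm A x = sqrt (Re (A_inner A x x))"

definition A_bounded_ops :: "('a::complex_hilbert_space \<Rightarrow> 'a) \<Rightarrow> ('a \<Rightarrow> 'a) set"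
  where "A_bounded_ops A = {T. bounded_clinear T \<and> range (cadjoint T \<circ> A) \<subseteq> range A}"

text \<open>For nonzero positive \<open>A\<close> and operators in \<open>A_bounded_ops A\<close> the real suprema
  below are taken over nonempty bounded sets.\<close>

definition A_numerical_radius :: "('a::complex_hilbert_space \<Rightarrow> 'a) \<Rightarrow> ('a \<Rightarrow> 'a) \<Rightarrow> real"
  where "A_numerical_radius A T = (SUP x\<in>{x. A_norm A x = 1}. cmod (A_inner A (T x) x))"

definition A_euclidean_radius ::
    "('a::complex_hilbert_space \<Rightarrow> 'a) \<Rightarrow> ('a \<Rightarrow> 'a) \<Rightarrow> ('a \<Rightarrow> 'a) \<Rightarrow> real"
  where "A_euclidean_radius A T S =
    (SUP x\<in>{x. A_norm A x = 1}.
       sqrt ((cmod (A_inner A (T x) x))\<^sup>2 + (cmod (A_inner A (S x) x))\<^sup>2))"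

end

theory Submission
  imports Defs
begin

text \<open>The inequalities follow pointwise from the parallelogram law in \<open>\<complex>\<close>, and \<open>T = S = id\<close>
  gives sharpness of both constants. The substance is the finiteness of the suprema. From
  \<open>\<langle>A T x | y\<rangle> = \<langle>A x | z\<rangle>\<close>, where \<open>T\<^sup>* A y = A z\<close>, uniform boundedness gives
  \<open>norm (A (T x)) \<le> M * norm (A x)\<close>. Choosing \<open>S\<close> with \<open>A S = T\<^sup>* A T\<close>, the map \<open>S\<close> is symmetric for
  the \<open>A\<close>-inner product, so the \<open>A\<close>-seminorms of the iterates \<open>S\<^sup>n x\<close> form a log-convex sequence of at
  most geometric growth. This forces \<open>S\<close>, and hence \<open>T\<close>, to be bounded in the \<open>A\<close>-seminorm.\<close>

section \<open>Algebra of the complex inner product and its norm\<close>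

lemma complex_of_nonneg_Reals:
  assumes "z \<in> \<real>\<^sub>\<ge>\<^sub>0"
  shows "z = complex_of_real (Re z)" "0 \<le> Re z"
  using assms by (auto elim: nonneg_Reals_cases)

lemma cinner_add_right: "cinner x (y + z) = cinner x y + cinner x z"
  by (metis cinner_add_left cinner_commute complex_cnj_add)

lemma cinner_scaleC_right: "cinner x (c *\<^sub>C y) = cnj c * cinner x y"
  by (metis cinner_scaleC_left cinner_commute complex_cnj_mult)

lemma cinner_scaleR_left: "cinner (r *\<^sub>R x) y = complex_of_real r * cinner x y"
  by (simp add: scaleR_scaleC cinner_scaleC_left)

lemma cinner_scaleR_right: "cinner x (r *\<^sub>R y) = complex_of_real r * cinner x y"
  by (simp add: scaleR_scaleC cinner_scaleC_right)

lemma cinner_zero_left: "cinner 0 x = 0"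
  using cinner_scaleR_left[of 0 0 x] by simp

lemma cinner_minus_left: "cinner (- x) y = - cinner x y"
  using cinner_scaleR_left[of "-1" x y] by simp

lemma cinner_minus_right: "cinner x (- y) = - cinner x y"
  using cinner_scaleR_right[of x "-1" y] by simp

lemma cinner_diff_left: "cinner (x - y) z = cinner x z - cinner y z"
  using cinner_add_left[of x "- y" z] by (simp add: cinner_minus_left)

lemma cinner_diff_right: "cinner x (y - z) = cinner x y - cinner x z"
  using cinner_add_right[of x y "- z"] by (simp add: cinner_minus_right)

lemma power2_norm_eq_cinner: "(norm x)\<^sup>2 = Re (cinner x x)"
  by (simp add: norm_eq_sqrt_cinner complex_of_nonneg_Reals(2)[OF cinner_self_nonneg])

lemma Re_cinner_commute: "Re (cinner x y) = Re (cinner y x)"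
  by (subst cinner_commute) simp

lemma power2_norm_add: "(norm (x + y))\<^sup>2 = (norm x)\<^sup>2 + 2 * Re (cinner x y) + (norm y)\<^sup>2"
  for x y :: "'a::complex_inner"
  by (simp add: power2_norm_eq_cinner cinner_add_left cinner_add_right Re_cinner_commute[of y x])

lemma power2_norm_diff: "(norm (x - y))\<^sup>2 = (norm x)\<^sup>2 - 2 * Re (cinner x y) + (norm y)\<^sup>2"
  for x y :: "'a::complex_inner"
  by (simp add: power2_norm_eq_cinner cinner_diff_left cinner_diff_right Re_cinner_commute[of y x])

lemma cinner_eqI:
  assumes "\<And>x. cinner x y = cinner x z"
  shows "y = z"
proof -
  have "cinner (y - z) (y - z) = 0"
    using assms[of "y - z"] by (simp add: cinner_diff_right)
  then show ?thesis
    by (simp add: cinner_self_eq_zero_iff)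
qed

lemma bounded_clinear_ops:
  assumes "bounded_clinear T"
  shows "T (x + y) = T x + T y" "T (x - y) = T x - T y" "T (c *\<^sub>C x) = c *\<^sub>C T x"
    "T (r *\<^sub>R x) = r *\<^sub>R T x"
proof -
  interpret bounded_linear T
    using assms by (simp add: bounded_clinear_def)
  show "T (x + y) = T x + T y" "T (x - y) = T x - T y" "T (c *\<^sub>C x) = c *\<^sub>C T x"
    "T (r *\<^sub>R x) = r *\<^sub>R T x"
    using assms by (simp_all add: add diff scaleR bounded_clinear_def)
qed

section \<open>Positive operators and the semi-inner product they induce\<close>

lemma positive_operator_id: "positive_operator (\<lambda>x. x)"
  by (auto simp: positive_operator_def bounded_clinear_def bounded_linear_ident cinner_self_nonneg)

text \<open>Polarization: reality of the quadratic form at \<open>x + y\<close> fixes the imaginary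
  parts, and reality at \<open>x + \<i> *\<^sub>C y\<close> the real parts.\<close>

lemma positive_operator_selfadjoint:
  assumes "positive_operator A"
  shows "cinner (A x) y = cinner x (A y)"
proof -
  have A: "bounded_clinear A" and pos: "Im (cinner (A u) u) = 0" for u
    using assms complex_of_nonneg_Reals(1)
    by (auto simp: positive_operator_def complex_nonneg_Reals_iff)
  have "Im (cinner (A x) y) + Im (cinner (A y) x) = 0"
    using pos[of "x + y"] pos[of x] pos[of y]
    by (simp add: bounded_clinear_ops[OF A] cinner_add_left cinner_add_right)
  moreover have "Re (cinner (A x) y) = Re (cinner (A y) x)"
    using pos[of "x + \<i> *\<^sub>C y"] pos[of x] pos[of y]
    by (simp add: bounded_clinear_ops[OF A] cinner_add_left cinner_add_right
        cinner_scaleC_left cinner_scaleC_right)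
  ultimately have "cinner (A x) y = cnj (cinner (A y) x)"
    by (simp add: complex_eq_iff)
  then show ?thesis
    by (simp add: cinner_commute[of x])
qed

lemma A_inner_self:
  assumes "positive_operator A"
  shows "A_inner A x x = complex_of_real ((A_norm A x)\<^sup>2)"
proof -
  have "A_inner A x x \<in> \<real>\<^sub>\<ge>\<^sub>0"
    using assms by (simp add: A_inner_def positive_operator_def)
  from complex_of_nonneg_Reals[OF this] show ?thesis
    by (metis A_norm_def real_sqrt_pow2)
qed

lemma A_norm_nonneg: "positive_operator A \<Longrightarrow> 0 \<le> A_norm A x"
  using complex_of_nonneg_Reals(2)[of "A_inner A x x"]
  by (simp add: A_inner_def A_norm_def positive_operator_def)

text \<open>A nonnegative quadratic in a real parameter has nonpositive discriminant. Since
  \<open>A_norm A\<close> is only a seminorm, its leading coefficient can vanish, and that case is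
  treated separately.\<close>

lemma A_inner_Cauchy_Schwarz:
  assumes "positive_operator A"
  shows "cmod (A_inner A x y) \<le> A_norm A x * A_norm A y"
proof -
  define a where "a = A_inner A x y"
  have A: "bounded_clinear A"
    using assms by (simp add: positive_operator_def)
  have yx: "cinner (A y) x = cnj a"
    using positive_operator_selfadjoint[OF assms, of x y]
    by (simp add: a_def A_inner_def cinner_commute[of "A y"])
  have quad: "0 \<le> (A_norm A x)\<^sup>2 - 2 * t * (cmod a)\<^sup>2 + t\<^sup>2 * (cmod a)\<^sup>2 * (A_norm A y)\<^sup>2" for t
  proof -
    \<comment> \<open>The factor \<open>a\<close> aligns the phase, so both cross terms become the
      real number \<open>- t * (cmod a)\<^sup>2\<close>.\<close>
    define c where "c = - complex_of_real t * a"
    have "A_inner A (x + c *\<^sub>C y) (x + c *\<^sub>C y)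
        = A_inner A x x + cnj c * a + c * cnj a + c * cnj c * A_inner A y y"
      using yx by (simp add: A_inner_def bounded_clinear_ops[OF A] cinner_add_left cinner_add_right
          cinner_scaleC_left cinner_scaleC_right a_def algebra_simps)
    also have "\<dots> = complex_of_real ((A_norm A x)\<^sup>2 - 2 * t * (cmod a)\<^sup>2
        + t\<^sup>2 * (cmod a)\<^sup>2 * (A_norm A y)\<^sup>2)"
      unfolding A_inner_self[OF assms]
      by (simp add: c_def complex_norm_square[of a] power2_eq_square[of t] algebra_simps
          del: of_real_power)
    finally show ?thesis
      unfolding A_inner_self[OF assms] of_real_eq_iff by (metis zero_le_power2)
  qed
  have "(cmod a)\<^sup>2 \<le> (A_norm A x)\<^sup>2 * (A_norm A y)\<^sup>2"
  proof (cases "A_norm A y = 0")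
    case True
    have "(cmod a)\<^sup>2 = 0"
    proof (rule ccontr)
      assume "(cmod a)\<^sup>2 \<noteq> 0"
      \<comment> \<open>With leading coefficient zero the expression is affine in \<open>t\<close>;
        at this \<open>t\<close> it equals -1.\<close>
      then show False
        using quad[of "((A_norm A x)\<^sup>2 + 1) / (2 * (cmod a)\<^sup>2)"] True by simp
    qed
    then show ?thesis
      by simp
  next
    case False
    then have pos: "0 < (A_norm A y)\<^sup>2"
      by simp
    \<comment> \<open>\<open>1 / (A_norm A y)\<^sup>2\<close> is where the quadratic attains its
      minimum.\<close>
    have "(1 / (A_norm A y)\<^sup>2)\<^sup>2 * (cmod a)\<^sup>2 * (A_norm A y)\<^sup>2 = (cmod a)\<^sup>2 / (A_norm A y)\<^sup>2"
      using pos by (simp only: power2_eq_square[of "1 / _"]) (simp add: field_simps)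
    with quad[of "1 / (A_norm A y)\<^sup>2"] have "(cmod a)\<^sup>2 / (A_norm A y)\<^sup>2 \<le> (A_norm A x)\<^sup>2"
      by simp
    then show ?thesis
      using pos by (simp add: pos_divide_le_eq)
  qed
  then have "(cmod a)\<^sup>2 \<le> (A_norm A x * A_norm A y)\<^sup>2"
    by (simp add: power_mult_distrib)
  then show ?thesis
    unfolding a_def
    by (rule power2_le_imp_le) (simp add: A_norm_nonneg[OF assms])
qed

section \<open>Riesz representation and adjoints\<close>

lemma cinner_Cauchy_Schwarz: "cmod (cinner x y) \<le> norm x * norm y"
  for x y :: "'a::complex_hilbert_space"
  using A_inner_Cauchy_Schwarz[OF positive_operator_id, of x y]
  by (simp add: A_inner_def A_norm_def norm_eq_sqrt_cinner)

text \<open>Minimize \<open>J u = (norm u)\<^sup>2 - 2 * f u\<close>; minimizing sequences are Cauchy by the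
  parallelogram law, and the minimizer represents \<open>f\<close>.\<close>

lemma Riesz_representation_Re:
  fixes f :: "'a::complex_hilbert_space \<Rightarrow> real"
  assumes f: "bounded_linear f"
  obtains z where "\<And>x. f x = Re (cinner x z)"
proof -
  interpret f: bounded_linear f by fact
  define J where "J = (\<lambda>u. (norm u)\<^sup>2 - 2 * f u)"
  define m where "m = Inf (range J)"
  obtain K where K: "\<And>x. norm (f x) \<le> norm x * K"
    using f.bounded by auto
  \<comment> \<open>Completing the square shows that \<open>J\<close> is bounded below, so the
    infimum \<open>m\<close> is meaningful.\<close>
  have "- K\<^sup>2 \<le> J u" for u
  proof -
    have "0 \<le> (norm u - K)\<^sup>2" by simp
    also have "\<dots> = (norm u)\<^sup>2 - 2 * (norm u * K) + K\<^sup>2"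
      by (simp add: power2_diff)
    finally show ?thesis
      using K[of u] by (simp add: J_def)
  qed
  then have bdd: "bdd_below (range J)"
    by (auto intro!: bdd_belowI[of _ "- K\<^sup>2"])
  then have m_le: "m \<le> J u" for u
    by (simp add: m_def cInf_lower)
  have "\<exists>u. J u < m + 1 / real (Suc n)" for n
    using cInf_lessD[of "range J" "m + 1 / real (Suc n)"] by (auto simp: m_def)
  then obtain u where u: "\<And>n. J (u n) < m + 1 / real (Suc n)"
    by metis
  have dist_le: "(norm (v - w))\<^sup>2 \<le> 2 * ((J v - m) + (J w - m))" for v w
  proof -
    have "4 * J ((1/2) *\<^sub>R (v + w)) = (norm (v + w))\<^sup>2 - 4 * (f v + f w)"
      unfolding J_def f.scaleR f.add norm_scaleR
      by (simp add: power_mult_distrib power2_eq_square add_divide_distrib)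
    moreover have "(norm (v + w))\<^sup>2 + (norm (v - w))\<^sup>2 = 2 * (norm v)\<^sup>2 + 2 * (norm w)\<^sup>2"
      by (simp add: power2_norm_add power2_norm_diff)
    ultimately show ?thesis
      using m_le[of "(1/2) *\<^sub>R (v + w)"] by (simp add: J_def)
  qed
  have "Cauchy u"
  proof (rule CauchyI)
    fix e :: real assume e: "0 < e"
    \<comment> \<open>Beyond index \<open>M\<close> each excess over \<open>m\<close> is below
      \<open>1 / real (Suc M)\<close>; \<open>dist_le\<close> doubles the sum of two of them, hence
      the 4.\<close>
    then obtain M where M: "4 / real (Suc M) < e\<^sup>2"
      using reals_Archimedean[of "e\<^sup>2 / 4"] by (auto simp: field_simps)
    have "norm (u i - u j) < e" if "M \<le> i" "M \<le> j" for i j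
    proof -
      have "1 / real (Suc i) \<le> 1 / real (Suc M)" "1 / real (Suc j) \<le> 1 / real (Suc M)"
        using that by (auto intro!: divide_left_mono)
      then have "(norm (u i - u j))\<^sup>2 < e\<^sup>2"
        using dist_le[of "u i" "u j"] u[of i] u[of j] M by simp
      then show ?thesis
        using e by (simp add: power_less_imp_less_base)
    qed
    then show "\<exists>M. \<forall>m\<ge>M. \<forall>n\<ge>M. norm (u m - u n) < e"
      by blast
  qed
  then obtain z where z: "u \<longlonglongrightarrow> z"
    using Cauchy_convergent convergent_def by blast
  have "(\<lambda>n. J (u n)) \<longlonglongrightarrow> J z"
    unfolding J_def by (intro tendsto_intros z f.tendsto)
  moreover have "(\<lambda>n. m + 1 / real (Suc n)) \<longlonglongrightarrow> m"
    using tendsto_add[OF tendsto_const[of m] LIMSEQ_inverse_real_of_nat]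
    by (simp add: inverse_eq_divide)
  ultimately have Jz: "J z \<le> m"
    by (rule LIMSEQ_le) (use u less_imp_le in blast)
  have "f x = Re (cinner x z)" for x
  proof -
    \<comment> \<open>\<open>d\<close> is half the derivative of \<open>J\<close> at
      \<open>z\<close> in direction \<open>x\<close>; it must vanish at a minimizer.\<close>
    define d where "d = Re (cinner z x) - f x"
    have var: "0 \<le> t\<^sup>2 * (norm x)\<^sup>2 + 2 * t * d" for t
    proof -
      have "J (z + t *\<^sub>R x) = J z + t\<^sup>2 * (norm x)\<^sup>2 + 2 * t * d"
        by (simp add: J_def d_def power2_norm_add f.add f.scaleR cinner_scaleR_right
            power_mult_distrib algebra_simps)
      then show ?thesis
        using m_le[of "z + t *\<^sub>R x"] Jz by simp
    qed
    have "d = 0"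
    proof (cases "x = 0")
      case True
      then show ?thesis
        using var[of 1] var[of "-1"] by simp
    next
      case False
      \<comment> \<open>The chosen \<open>t\<close> minimizes the quadratic in \<open>var\<close>,
        with value \<open>- d\<^sup>2 / (norm x)\<^sup>2\<close>.\<close>
      then have "0 \<le> - d\<^sup>2"
        using var[of "- d / (norm x)\<^sup>2"]
        by (simp add: field_simps power2_eq_square)
      then show ?thesis by simp
    qed
    then show ?thesis
      by (simp add: d_def Re_cinner_commute[of x])
  qed
  then show thesis
    by (rule that)
qed

lemma bounded_linear_cinner_left:
  "bounded_linear (\<lambda>x. cinner x (y :: 'a::complex_hilbert_space))"
  by (rule bounded_linear_intro[where K = "norm y"])
    (simp_all add: cinner_add_left cinner_scaleR_left cinner_Cauchy_Schwarz scaleR_conv_of_real)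

lemma bounded_linear_cinner_right:
  "bounded_linear (\<lambda>y. cinner (x :: 'a::complex_hilbert_space) y)"
proof (rule bounded_linear_intro[where K = "norm x"])
  show "norm (cinner x y) \<le> norm y * norm x" for y
    using cinner_Cauchy_Schwarz[of x y] by (simp add: mult.commute)
qed (simp_all add: cinner_add_right cinner_scaleR_right scaleR_conv_of_real)

text \<open>Vectors are determined by their inner products, so any map with the adjoint property is
  the one that the definite description in \<open>cadjoint\<close> selects.\<close>

lemma adjoint_unique:
  assumes "\<And>x y. cinner (T x) y = cinner x (S y)"
  shows "cadjoint T = S"
  unfolding cadjoint_def
proof (rule the_equality)
  show "\<forall>x y. cinner (T x) y = cinner x (S y)"
    using assms by simp
next
  fix S' assume S': "\<forall>x y. cinner (T x) y = cinner x (S' y)"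
  show "S' = S"
  proof (rule ext, rule cinner_eqI)
    show "cinner x (S' y) = cinner x (S y)" for x y
      using S' assms[of x y] by simp
  qed
qed

lemma cinner_cadjoint:
  assumes T: "bounded_clinear T"
  shows "cinner (T x) y = cinner x (cadjoint T y)"
proof -
  have bl: "bounded_linear T"
    using T by (simp add: bounded_clinear_def)
  have "\<exists>z. \<forall>x. cinner (T x) y = cinner x z" for y
  proof -
    have "bounded_linear (\<lambda>x. Re (cinner (T x) y))"
      using bounded_linear_compose[OF bounded_linear_Re
          bounded_linear_compose[OF bounded_linear_cinner_left bl]] .
    then obtain z where z: "\<And>x. Re (cinner (T x) y) = Re (cinner x z)"
      using Riesz_representation_Re by metis
    \<comment> \<open>Multiplying \<open>x\<close> by the imaginary unit turns the real-part
      identity into the one for imaginary parts.\<close>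
    have "Im (cinner (T x) y) = Im (cinner x z)" for x
      using z[of "\<i> *\<^sub>C x"] by (simp add: bounded_clinear_ops[OF T] cinner_scaleC_left)
    with z show ?thesis
      by (auto simp: complex_eq_iff)
  qed
  then obtain S where S: "\<And>x y. cinner (T x) y = cinner x (S y)"
    by metis
  with adjoint_unique[of T S] show ?thesis
    by simp
qed

text \<open>Test the adjoint identity at \<open>x = cadjoint T y\<close> and cancel one factor of
  the norm.\<close>

lemma norm_cadjoint_le:
  assumes T: "bounded_clinear T" and N: "\<And>x. norm (T x) \<le> N * norm x"
  shows "norm (cadjoint T y) \<le> N * norm y"
proof -
  let ?z = "cadjoint T y"
  have "(norm ?z)\<^sup>2 = Re (cinner (T ?z) y)"
    by (simp add: power2_norm_eq_cinner cinner_cadjoint[OF T])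
  also have "\<dots> \<le> norm (T ?z) * norm y"
    using complex_Re_le_cmod cinner_Cauchy_Schwarz order_trans by blast
  also have "\<dots> \<le> N * norm ?z * norm y"
    by (simp add: N mult_right_mono)
  finally have "norm ?z * norm ?z \<le> norm ?z * (N * norm y)"
    by (simp add: power2_eq_square algebra_simps)
  \<comment> \<open>No sign of \<open>N\<close> is assumed; the bound at \<open>y\<close> itself
    supplies it when \<open>y\<close> is nonzero. This settles the case where the adjoint value
    vanishes.\<close>
  moreover have "0 \<le> N * norm y"
    by (cases "y = 0") (use N[of y] norm_ge_zero[of "T y"] in linarith)+
  ultimately show ?thesis
    by (cases "norm ?z = 0") auto
qed

section \<open>The uniform boundedness principle\<close>

theorem uniform_boundedness:
  fixes F :: "('a::{real_normed_vector,complete_space} \<Rightarrow> 'b::real_normed_vector) set"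
  assumes lin: "\<And>f. f \<in> F \<Longrightarrow> bounded_linear f"
    and bdd: "\<And>x. \<exists>K. \<forall>f\<in>F. norm (f x) \<le> K"
  obtains M where "0 \<le> M" "\<And>f x. f \<in> F \<Longrightarrow> norm (f x) \<le> M * norm x"
proof -
  define G where "G n = {x. \<forall>f\<in>F. norm (f x) \<le> real n}" for n
  have closed: "closed (G n)" for n
  proof -
    have "G n = (\<Inter>f\<in>F. {x. norm (f x) \<le> real n})"
      by (auto simp: G_def)
    moreover have "closed {x. norm (f x) \<le> real n}" if "f \<in> F" for f
      using linear_continuous_on[OF lin[OF that]]
      by (intro closed_Collect_le continuous_intros) auto
    ultimately show ?thesis
      by auto
  qed
  have cover: "(\<Union>n. G n) = UNIV"
  proof (intro equalityI subset_UNIV subsetI)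
    fix x
    obtain K where "\<forall>f\<in>F. norm (f x) \<le> K"
      using bdd by blast
    moreover obtain n where "K \<le> real n"
      using real_arch_simple by blast
    ultimately show "x \<in> (\<Union>n. G n)"
      by (auto simp: G_def intro: order_trans)
  qed
  \<comment> \<open>Baire: countably many closed sets with empty interior cannot cover a complete
    space, so some \<open>G n\<close> contains a ball.\<close>
  have "interior (\<Union>n. G n) = {}" if empty: "\<And>n. interior (G n) = {}"
  proof -
    have "mcomplete_of (euclidean_metric :: 'a metric)"
      by (simp add: mcomplete_of_def complete_UNIV)
    then have "Met_TC.mtopology interior_of \<Union> (range G) = {}"
      using closed empty
      by (intro Met_TC.metric_Baire_category_alt) (auto simp: complete_UNIV)
    then show ?thesis
      by simp
  qed
  then obtain n where n: "interior (G n) \<noteq> {}"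
    unfolding cover interior_UNIV by blast
  then obtain c e where e: "0 < e" and ball: "cball c e \<subseteq> G n"
    by (meson all_not_in_conv mem_interior_cball)
  have "norm (f x) \<le> (2 * real n / e) * norm x" if f: "f \<in> F" for f x
  proof (cases "x = 0")
    case True
    then show ?thesis
      using linear_simps(3)[OF lin[OF f]] by simp
  next
    case False
    interpret f: bounded_linear f by (rule lin[OF f])
    \<comment> \<open>Rescaling \<open>x\<close> to norm \<open>e\<close> keeps \<open>c + y\<close>
      in the ball, and \<open>f y\<close> is the difference of two values bounded by
      \<open>n\<close>.\<close>
    define y where "y = (e / norm x) *\<^sub>R x"
    have "c \<in> cball c e" "c + y \<in> cball c e"
      using e False by (simp_all add: y_def dist_norm)
    then have "norm (f c) \<le> real n" "norm (f (c + y)) \<le> real n"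
      using ball f unfolding G_def by blast+
    then have "norm (f (c + y) - f c) \<le> 2 * real n"
      using norm_triangle_ineq4[of "f (c + y)" "f c"] by linarith
    then have "norm (f y) \<le> 2 * real n"
      by (simp add: f.add)
    moreover have "norm (f y) = e / norm x * norm (f x)"
      using e by (simp add: y_def f.scaleR)
    ultimately show ?thesis
      using e False by (simp add: field_simps)
  qed
  moreover have "0 \<le> 2 * real n / e"
    using e by simp
  ultimately show thesis
    using that by blast
qed

section \<open>Boundedness with respect to the \<open>A\<close>-seminorm\<close>

lemma A_bounded_ops_norm_le:
  assumes A: "positive_operator A" and T: "T \<in> A_bounded_ops A"
  obtains M where "0 \<le> M" "\<And>x. norm (A (T x)) \<le> M * norm (A x)"
proof -
  have bT: "bounded_clinear T" and ran: "range (cadjoint T \<circ> A) \<subseteq> range A"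
    using T by (auto simp: A_bounded_ops_def)
  have pointwise: "\<exists>z. \<forall>x. cinner (A (T x)) y = cinner (A x) z" for y
  proof -
    obtain z where "cadjoint T (A y) = A z"
      using ran by auto
    then show ?thesis
      by (metis positive_operator_selfadjoint[OF A] cinner_cadjoint[OF bT])
  qed
  \<comment> \<open>These functionals are conjugate-linear, hence real-linear, which is the
    linearity that uniform boundedness asks for. When \<open>A x = 0\<close>, division by zero gives
    0 and the functional is zero.\<close>
  define F where "F = range (\<lambda>x. cinner ((1 / norm (A x)) *\<^sub>R A (T x)))"
  have "\<exists>K. \<forall>f\<in>F. norm (f y) \<le> K" for y
  proof -
    obtain z where z: "\<And>x. cinner (A (T x)) y = cinner (A x) z"
      using pointwise by blast
    have "norm (cinner ((1 / norm (A x)) *\<^sub>R A (T x)) y) \<le> norm z" for x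
      using cinner_Cauchy_Schwarz[of "A x" z]
      by (cases "A x = 0") (simp_all add: cinner_zero_left cinner_scaleR_left z norm_mult norm_divide field_simps)
    then show ?thesis
      by (auto simp: F_def)
  qed
  moreover have "bounded_linear f" if "f \<in> F" for f
    using that by (auto simp: F_def intro!: bounded_linear_cinner_right)
  ultimately obtain M where M: "0 \<le> M" "\<And>f y. f \<in> F \<Longrightarrow> norm (f y) \<le> M * norm y"
    using uniform_boundedness[of F] by metis
  have "norm (A (T x)) \<le> M * norm (A x)" for x
  proof -
    let ?w = "A (T x)"
    \<comment> \<open>The uniform bound is tested at the vector \<open>A (T x)\<close> itself, which
      turns it into a bound on its norm.\<close>
    have "cmod (cinner ?w ?w) \<le> M * norm (A x) * norm ?w"
    proof (cases "A x = 0")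
      case True
      then show ?thesis
        using pointwise[of ?w] by (auto simp: cinner_zero_left)
    next
      case False
      have "cmod (cinner ((1 / norm (A x)) *\<^sub>R ?w) ?w) \<le> M * norm ?w"
        by (rule M) (simp add: F_def)
      with False show ?thesis
        by (simp add: cinner_scaleR_left norm_mult norm_divide field_simps)
    qed
    moreover have "(norm ?w)\<^sup>2 \<le> cmod (cinner ?w ?w)"
      by (simp add: power2_norm_eq_cinner complex_Re_le_cmod)
    ultimately have "norm ?w * norm ?w \<le> M * norm (A x) * norm ?w"
      by (simp add: power2_eq_square)
    with M(1) show ?thesis
      by (cases "norm ?w = 0") auto
  qed
  with M(1) show thesis
    by (rule that)
qed

text \<open>Log-convexity makes successive ratios nondecreasing, so a first ratio above
  \<open>K\<close> would force growth faster than \<open>K ^ n\<close>. The growth bound is on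
  squares because squared seminorms of iterates are what gets estimated.\<close>

lemma log_convex_first_ratio_le:
  fixes a :: "nat \<Rightarrow> real"
  assumes nonneg: "\<And>n. 0 \<le> a n"
    and convex: "\<And>n. (a (Suc n))\<^sup>2 \<le> a n * a (Suc (Suc n))"
    and growth: "\<And>n. (a n)\<^sup>2 \<le> C * K ^ (2 * n)" and K: "0 \<le> K"
  shows "a 1 \<le> K * a 0"
proof (rule ccontr)
  assume neg: "\<not> a 1 \<le> K * a 0"
  moreover have "0 \<le> K * a 0"
    using K nonneg by simp
  ultimately have a1: "0 < a 1"
    by linarith
  \<comment> \<open>Log-convexity at index 0 excludes \<open>a 0 = 0\<close>, so the ratio
    \<open>r\<close> is legitimate.\<close>
  have a0: "0 < a 0"
  proof -
    have "0 < (a 1)\<^sup>2" using a1 by simp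
    also have "\<dots> \<le> a 0 * a 2"
      using convex[of 0] by (simp add: numeral_2_eq_2)
    finally show ?thesis
      using nonneg[of 0] by (cases "a 0 = 0") auto
  qed
  define r where "r = a 1 / a 0"
  have r: "K < r" "0 < r"
    using neg a0 a1 by (simp_all add: r_def field_simps)
  have ratio: "0 < a n \<and> r * a n \<le> a (Suc n)" for n
  proof (induction n)
    case 0
    then show ?case using a0 by (simp add: r_def)
  next
    case (Suc n)
    have pos: "0 < a (Suc n)"
      using Suc r mult_pos_pos[of r "a n"] by linarith
    have "a n * (r * a (Suc n)) \<le> a (Suc n) * a (Suc n)"
      using mult_right_mono[of "r * a n" "a (Suc n)" "a (Suc n)"] Suc pos by (simp add: mult_ac)
    also have "\<dots> \<le> a n * a (Suc (Suc n))"
      using convex[of n] by (simp add: power2_eq_square)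
    finally show ?case
      using Suc pos by simp
  qed
  have lower: "a 0 * r ^ n \<le> a n" for n
  proof (induction n)
    case (Suc n)
    have "a 0 * r ^ Suc n = r * (a 0 * r ^ n)" by simp
    also have "\<dots> \<le> r * a n" using Suc r by simp
    finally show ?case using ratio[of n] by linarith
  qed simp
  have C: "(a 0)\<^sup>2 * ((r\<^sup>2) ^ n) \<le> C * (K\<^sup>2) ^ n" for n
  proof -
    have "(a 0 * r ^ n)\<^sup>2 \<le> (a n)\<^sup>2"
      using lower a0 r by (intro power_mono) auto
    also have "\<dots> \<le> C * K ^ (2 * n)"
      by (rule growth)
    finally show ?thesis
      by (simp add: power_mult_distrib power_mult[symmetric] mult.commute)
  qed
  \<comment> \<open>Comparing the lower and upper geometric bounds leaves
    \<open>(a 0)\<^sup>2 \<le> C * q ^ n\<close> with \<open>q < 1\<close>, which tends to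
    0.\<close>
  define q where "q = K\<^sup>2 / r\<^sup>2"
  have q: "0 \<le> q" "q < 1"
    using r K by (auto simp: q_def power_strict_mono)
  have "(a 0)\<^sup>2 \<le> C * q ^ n" for n
    using C[of n] r by (simp add: q_def power_divide field_simps)
  moreover have "(\<lambda>n. C * q ^ n) \<longlonglongrightarrow> C * 0"
    using q by (intro tendsto_intros LIMSEQ_power_zero) auto
  ultimately have "(a 0)\<^sup>2 \<le> C * 0"
    by (intro LIMSEQ_le_const) auto
  with a0 show False
    by simp
qed

lemma A_bounded_ops_A_norm_le:
  assumes A: "positive_operator A" and T: "T \<in> A_bounded_ops A"
  obtains K where "\<And>x. (A_norm A (T x))\<^sup>2 \<le> K * (A_norm A x)\<^sup>2"
proof -
  have bT: "bounded_clinear T" and ran: "range (cadjoint T \<circ> A) \<subseteq> range A"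
    using T by (auto simp: A_bounded_ops_def)
  obtain M where M: "0 \<le> M" "\<And>x. norm (A (T x)) \<le> M * norm (A x)"
    using A_bounded_ops_norm_le[OF A T] by metis
  obtain N where N: "0 \<le> N" "\<And>x. norm (T x) \<le> N * norm x"
    using bounded_linear.nonneg_bounded[of T] bT
    by (metis bounded_clinear_def mult.commute)
  define K where "K = N * M"
  have K: "0 \<le> K"
    using M N by (simp add: K_def)
  have "\<exists>z. cadjoint T (A (T x)) = A z" for x
    using ran by auto
  \<comment> \<open>\<open>S\<close> is chosen pointwise from the range condition and need not be
    linear; the argument works with the identity that \<open>A\<close> after \<open>S\<close> is
    \<open>cadjoint T\<close> after \<open>A\<close> after \<open>T\<close>.\<close>
  then obtain S where S: "\<And>x. cadjoint T (A (T x)) = A (S x)"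
    by metis
  have S_inner: "A_inner A (S x) y = A_inner A (T x) (T y)" for x y
    using cinner_cadjoint[OF bT, of y "A (T x)"]
    by (simp add: A_inner_def flip: S) (metis cinner_commute)
  have S_sym: "A_inner A (S x) y = A_inner A x (S y)" for x y
    unfolding S_inner
    using cinner_cadjoint[OF bT, of x "A (T y)"]
    by (simp add: A_inner_def positive_operator_selfadjoint[OF A] flip: S)
  have S_norm: "norm (A (S x)) \<le> K * norm (A x)" for x
  proof -
    have "norm (A (S x)) \<le> N * norm (A (T x))"
      using norm_cadjoint_le[OF bT N(2)] by (simp flip: S)
    also have "\<dots> \<le> N * (M * norm (A x))"
      using M N by (simp add: mult_left_mono)
    finally show ?thesis
      by (simp add: K_def mult.assoc)
  qed
  have S_bound: "A_norm A (S x) \<le> K * A_norm A x" for x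
  proof -
    define a where "a n = A_norm A ((S ^^ n) x)" for n
    have pow_norm: "norm (A ((S ^^ n) x)) \<le> K ^ n * norm (A x)" for n
    proof (induction n)
      case (Suc n)
      have "norm (A ((S ^^ Suc n) x)) \<le> K * norm (A ((S ^^ n) x))"
        using S_norm by simp
      also have "\<dots> \<le> K * (K ^ n * norm (A x))"
        using Suc K by (simp add: mult_left_mono)
      finally show ?case by (simp add: mult.assoc)
    qed simp
    have shift: "A_inner A ((S ^^ m) u) v = A_inner A u ((S ^^ m) v)" for m u v
    proof (induction m arbitrary: v)
      case (Suc m)
      then show ?case by (simp add: S_sym) (simp add: funpow_swap1)
    qed simp
    have sq: "complex_of_real ((a n)\<^sup>2) = A_inner A ((S ^^ n) x) ((S ^^ n) x)" for n
      by (simp add: a_def A_inner_self[OF A])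
    \<comment> \<open>The constant \<open>C\<close> depends on \<open>x\<close> but disappears from
      the conclusion, so the resulting bound is uniform in \<open>x\<close>.\<close>
    have "a 1 \<le> K * a 0"
    proof (rule log_convex_first_ratio_le[where C = "norm (A x) * norm x"])
      show "0 \<le> a n" for n
        by (simp add: a_def A_norm_nonneg[OF A])
      show "(a (Suc n))\<^sup>2 \<le> a n * a (Suc (Suc n))" for n
      proof -
        \<comment> \<open>Symmetry moves one \<open>S\<close> to the other side; Cauchy-Schwarz for
          the \<open>A\<close>-inner product then gives log-convexity.\<close>
        have "complex_of_real ((a (Suc n))\<^sup>2) = A_inner A ((S ^^ n) x) ((S ^^ Suc (Suc n)) x)"
          unfolding sq by (simp add: S_sym)
        then have "(a (Suc n))\<^sup>2 = cmod (A_inner A ((S ^^ n) x) ((S ^^ Suc (Suc n)) x))"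
          by (metis norm_of_real abs_power2 real_norm_def)
        then show ?thesis
          using A_inner_Cauchy_Schwarz[OF A] by (simp add: a_def)
      qed
      show "(a n)\<^sup>2 \<le> norm (A x) * norm x * K ^ (2 * n)" for n
      proof -
        \<comment> \<open>Now all \<open>n\<close> copies of \<open>S\<close> move to the left, so
          the ordinary Cauchy-Schwarz inequality and \<open>pow_norm\<close> apply at exponent
          \<open>2 * n\<close>.\<close>
        have "complex_of_real ((a n)\<^sup>2) = A_inner A ((S ^^ (2 * n)) x) x"
          unfolding sq by (simp add: shift[symmetric] mult_2 funpow_add)
        then have "(a n)\<^sup>2 = cmod (cinner (A ((S ^^ (2 * n)) x)) x)"
          by (metis A_inner_def norm_of_real abs_power2 real_norm_def)
        also have "\<dots> \<le> norm (A ((S ^^ (2 * n)) x)) * norm x"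
          by (rule cinner_Cauchy_Schwarz)
        also have "\<dots> \<le> K ^ (2 * n) * norm (A x) * norm x"
          by (intro mult_right_mono pow_norm) simp
        finally show ?thesis
          by (simp add: mult_ac)
      qed
    qed (rule K)
    then show ?thesis
      by (simp add: a_def)
  qed
  have "(A_norm A (T x))\<^sup>2 \<le> K * (A_norm A x)\<^sup>2" for x
  proof -
    have "complex_of_real ((A_norm A (T x))\<^sup>2) = A_inner A (S x) x"
      by (simp add: S_inner A_inner_self[OF A])
    then have "(A_norm A (T x))\<^sup>2 = cmod (A_inner A (S x) x)"
      by (metis norm_of_real abs_power2 real_norm_def)
    also have "\<dots> \<le> A_norm A (S x) * A_norm A x"
      by (rule A_inner_Cauchy_Schwarz[OF A])
    also have "\<dots> \<le> K * A_norm A x * A_norm A x"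
      by (intro mult_right_mono S_bound A_norm_nonneg[OF A])
    finally show ?thesis
      by (simp add: power2_eq_square mult.assoc)
  qed
  then show thesis
    by (rule that)
qed

text \<open>This gives the upper bounds needed to compare values with their conditionally complete
  suprema.\<close>

lemma A_bounded_ops_bound:
  assumes A: "positive_operator A" and T: "T \<in> A_bounded_ops A"
  obtains K where "\<And>x. A_norm A x = 1 \<Longrightarrow> cmod (A_inner A (T x) x) \<le> K"
proof -
  obtain K where K: "\<And>x. (A_norm A (T x))\<^sup>2 \<le> K * (A_norm A x)\<^sup>2"
    using A_bounded_ops_A_norm_le[OF A T] by metis
  have "cmod (A_inner A (T x) x) \<le> sqrt K" if "A_norm A x = 1" for x
  proof -
    have "cmod (A_inner A (T x) x) \<le> A_norm A (T x)"
      using A_inner_Cauchy_Schwarz[OF A, of "T x" x] that by simp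
    also have "\<dots> \<le> sqrt K"
      using K[of x] that by (simp add: real_le_rsqrt)
    finally show ?thesis .
  qed
  then show thesis
    by (rule that)
qed

section \<open>Unit vectors and the extremal example\<close>

text \<open>If \<open>A u\<close> is nonzero then so is the seminorm of \<open>u\<close>, by
  Cauchy-Schwarz against \<open>A u\<close>; normalize \<open>u\<close>. Hence the suprema range
  over a nonempty set.\<close>

lemma A_unit_vector_exists:
  assumes A: "positive_operator A" and nz: "A \<noteq> (\<lambda>x. 0)"
  obtains x where "A_norm A x = 1"
proof -
  have bA: "bounded_clinear A"
    using A by (simp add: positive_operator_def)
  obtain u where u: "A u \<noteq> 0"
    using nz by auto
  have "A_norm A u \<noteq> 0"
  proof
    assume "A_norm A u = 0"
    then have "cinner (A u) (A u) = 0"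
      using A_inner_Cauchy_Schwarz[OF A, of u "A u"] by (simp add: A_inner_def)
    with u show False
      by (simp add: cinner_self_eq_zero_iff)
  qed
  moreover have "A_norm A (r *\<^sub>R u) = \<bar>r\<bar> * A_norm A u" for r
    by (simp add: A_norm_def A_inner_def bounded_clinear_ops[OF bA] cinner_scaleR_left
        cinner_scaleR_right real_sqrt_mult flip: mult.assoc)
  ultimately have "A_norm A ((1 / A_norm A u) *\<^sub>R u) = 1"
    using A_norm_nonneg[OF A, of u] by simp
  then show thesis
    by (rule that)
qed

lemma id_in_A_bounded_ops: "(\<lambda>x. x :: 'a::complex_hilbert_space) \<in> A_bounded_ops A"
proof -
  have "cadjoint (\<lambda>x. x) = (\<lambda>x. x :: 'a)"
    by (rule adjoint_unique) simp
  then show ?thesis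
    using positive_operator_id by (auto simp: A_bounded_ops_def positive_operator_def)
qed

text \<open>For \<open>T = S = id\<close> every supremum is over a constant function. Both
  inequalities of the theorem are then equalities, with common value \<open>sqrt 2\<close>.\<close>

lemma A_radii_id:
  assumes A: "positive_operator A" and nz: "A \<noteq> (\<lambda>x. 0)"
  shows "A_numerical_radius A (\<lambda>x. x + x) = 2" "A_numerical_radius A (\<lambda>x. x - x) = 0"
    "A_euclidean_radius A (\<lambda>x. x) (\<lambda>x. x) = sqrt 2"
proof -
  have bA: "bounded_clinear A"
    using A by (simp add: positive_operator_def)
  have ne: "{x. A_norm A x = 1} \<noteq> {}"
    using A_unit_vector_exists[OF A nz] by blast
  have one: "A_inner A x x = 1" "A_inner A (x + x) x = 2" "A_inner A 0 x = 0"
    if "A_norm A x = 1" for x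
    using that A_inner_self[OF A, of x] bounded_clinear_ops(4)[OF bA, of 0 x]
      cinner_scaleR_left[of 0 x x]
    by (simp_all add: A_inner_def bounded_clinear_ops[OF bA] cinner_add_left)
  show "A_numerical_radius A (\<lambda>x. x + x) = 2" "A_numerical_radius A (\<lambda>x. x - x) = 0"
    "A_euclidean_radius A (\<lambda>x. x) (\<lambda>x. x) = sqrt 2"
    using ne by (simp_all add: A_numerical_radius_def A_euclidean_radius_def one cong: SUP_cong_simp)
qed

section \<open>The two inequalities and sharpness\<close>

lemma power2_cmod_parallelogram:
  "(cmod (a + b))\<^sup>2 + (cmod (a - b))\<^sup>2 = 2 * ((cmod a)\<^sup>2 + (cmod b)\<^sup>2)"
  by (simp add: cmod_power2) (simp add: power2_eq_square algebra_simps)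

lemma A_euclidean_radius_bounds:
  assumes A: "positive_operator A" and nz: "A \<noteq> (\<lambda>x. 0)"
    and T: "T \<in> A_bounded_ops A" and S: "S \<in> A_bounded_ops A"
  shows "sqrt 2 / 2 * max (A_numerical_radius A (\<lambda>x. T x + S x))
            (A_numerical_radius A (\<lambda>x. T x - S x)) \<le> A_euclidean_radius A T S" (is ?lower)
    and "A_euclidean_radius A T S \<le> sqrt 2 / 2 * sqrt ((A_numerical_radius A (\<lambda>x. T x + S x))\<^sup>2
            + (A_numerical_radius A (\<lambda>x. T x - S x))\<^sup>2)" (is ?upper)
proof -
  let ?U = "{x. A_norm A x = 1}"
  let ?t = "\<lambda>x. A_inner A (T x) x" and ?s = "\<lambda>x. A_inner A (S x) x"
  let ?e = "\<lambda>x. sqrt ((cmod (?t x))\<^sup>2 + (cmod (?s x))\<^sup>2)"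
  let ?P = "A_numerical_radius A (\<lambda>x. T x + S x)" and ?M = "A_numerical_radius A (\<lambda>x. T x - S x)"
  let ?E = "A_euclidean_radius A T S"
  have bA: "bounded_clinear A"
    using A by (simp add: positive_operator_def)
  have ne: "?U \<noteq> {}"
    using A_unit_vector_exists[OF A nz] by blast
  have plus: "A_inner A (T x + S x) x = ?t x + ?s x"
    and minus: "A_inner A (T x - S x) x = ?t x - ?s x" for x
    by (simp_all add: A_inner_def bounded_clinear_ops[OF bA] cinner_add_left cinner_diff_left)
  obtain K L where K: "\<And>x. A_norm A x = 1 \<Longrightarrow> cmod (?t x) \<le> K"
    and L: "\<And>x. A_norm A x = 1 \<Longrightarrow> cmod (?s x) \<le> L"
    using A_bounded_ops_bound[OF A T] A_bounded_ops_bound[OF A S] by metis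
  have KL: "cmod (?t x) + cmod (?s x) \<le> K + L" if "x \<in> ?U" for x
    using that K L by (simp add: add_mono)
  have "bdd_above ((\<lambda>x. cmod (?t x + ?s x)) ` ?U)"
    by (intro bdd_aboveI2[of _ _ "K + L"] order_trans[OF norm_triangle_ineq KL])
  then have P: "cmod (?t x + ?s x) \<le> ?P" if "x \<in> ?U" for x
    unfolding A_numerical_radius_def plus using that by (intro cSUP_upper)
  have "bdd_above ((\<lambda>x. cmod (?t x - ?s x)) ` ?U)"
    by (intro bdd_aboveI2[of _ _ "K + L"] order_trans[OF norm_triangle_ineq4 KL])
  then have M: "cmod (?t x - ?s x) \<le> ?M" if "x \<in> ?U" for x
    unfolding A_numerical_radius_def minus using that by (intro cSUP_upper)
  have "bdd_above (?e ` ?U)"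
    by (intro bdd_aboveI2[of _ _ "K + L"] order_trans[OF sqrt_sum_squares_le_sum KL]) auto
  then have E: "?e x \<le> ?E" if "x \<in> ?U" for x
    unfolding A_euclidean_radius_def using that by (intro cSUP_upper)
  \<comment> \<open>The parallelogram law rewrites the Euclidean quantity through sum and
    difference; the constant \<open>sqrt 2 / 2\<close> originates here.\<close>
  have e_eq: "?e x = sqrt 2 / 2 * sqrt ((cmod (?t x + ?s x))\<^sup>2 + (cmod (?t x - ?s x))\<^sup>2)" for x
    unfolding power2_cmod_parallelogram real_sqrt_mult by simp
  have "?P \<le> sqrt 2 * ?E" "?M \<le> sqrt 2 * ?E"
  proof -
    have "cmod (?t x + ?s x) \<le> sqrt 2 * ?E \<and> cmod (?t x - ?s x) \<le> sqrt 2 * ?E" if "x \<in> ?U" for x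
    proof -
      \<comment> \<open>Each of the two moduli is at most the root of the sum of their
        squares.\<close>
      have "sqrt ((cmod (?t x + ?s x))\<^sup>2 + (cmod (?t x - ?s x))\<^sup>2) = sqrt 2 * ?e x"
        unfolding e_eq by simp
      also have "\<dots> \<le> sqrt 2 * ?E"
        using E[OF that] by simp
      finally show ?thesis
        by (meson order_trans real_sqrt_sum_squares_ge1 real_sqrt_sum_squares_ge2)
    qed
    then show "?P \<le> sqrt 2 * ?E" "?M \<le> sqrt 2 * ?E"
      unfolding A_numerical_radius_def plus minus using ne by (auto intro!: cSUP_least)
  qed
  then have "sqrt 2 / 2 * max ?P ?M \<le> sqrt 2 / 2 * (sqrt 2 * ?E)"
    by (intro mult_left_mono) auto
  then show ?lower
    by (simp only: mult.assoc[symmetric]) simp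
  \<comment> \<open>Each modulus is bounded by its own supremum; the two suprema need not be
    approached at the same \<open>x\<close>.\<close>
  have "?e x \<le> sqrt 2 / 2 * sqrt (?P\<^sup>2 + ?M\<^sup>2)" if "x \<in> ?U" for x
    unfolding e_eq
    using P[OF that] M[OF that]
    by (intro mult_left_mono real_sqrt_le_mono add_mono power_mono) auto
  then show ?upper
    unfolding A_euclidean_radius_def[of A T S] using ne by (intro cSUP_least)
qed

theorem theorem2p7:
  fixes A :: "'a::complex_hilbert_space \<Rightarrow> 'a"
  assumes "positive_operator A" and "A \<noteq> (\<lambda>x. 0)"
  shows
    "(\<forall>T \<in> A_bounded_ops A. \<forall>S \<in> A_bounded_ops A.
        sqrt 2 / 2 * max (A_numerical_radius A (\<lambda>x. T x + S x))
                         (A_numerical_radius A (\<lambda>x. T x - S x))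
          \<le> A_euclidean_radius A T S
      \<and> A_euclidean_radius A T S
          \<le> sqrt 2 / 2 * sqrt ((A_numerical_radius A (\<lambda>x. T x + S x))\<^sup>2
                              + (A_numerical_radius A (\<lambda>x. T x - S x))\<^sup>2))
   \<and> (\<forall>c::real. c > 0 \<longrightarrow>
        (\<forall>T \<in> A_bounded_ops A. \<forall>S \<in> A_bounded_ops A.
           c * max (A_numerical_radius A (\<lambda>x. T x + S x))
                   (A_numerical_radius A (\<lambda>x. T x - S x))
             \<le> A_euclidean_radius A T S) \<longrightarrow>
        c \<le> sqrt 2 / 2)
   \<and> (\<forall>C::real. C > 0 \<longrightarrow>
        (\<forall>T \<in> A_bounded_ops A. \<forall>S \<in> A_bounded_ops A.
           A_euclidean_radius A T S
             \<le> C * sqrt ((A_numerical_radius A (\<lambda>x. T x + S x))\<^sup>2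
                        + (A_numerical_radius A (\<lambda>x. T x - S x))\<^sup>2)) \<longrightarrow>
        C \<ge> sqrt 2 / 2)"
proof (intro conjI ballI allI impI)
  fix T S assume T: "T \<in> A_bounded_ops A" and S: "S \<in> A_bounded_ops A"
  show "sqrt 2 / 2 * max (A_numerical_radius A (\<lambda>x. T x + S x))
      (A_numerical_radius A (\<lambda>x. T x - S x)) \<le> A_euclidean_radius A T S"
    and "A_euclidean_radius A T S \<le> sqrt 2 / 2 * sqrt ((A_numerical_radius A (\<lambda>x. T x + S x))\<^sup>2
      + (A_numerical_radius A (\<lambda>x. T x - S x))\<^sup>2)"
    by (rule A_euclidean_radius_bounds[OF assms T S])+
next
  fix c :: real
  assume "\<forall>T \<in> A_bounded_ops A. \<forall>S \<in> A_bounded_ops A.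
    c * max (A_numerical_radius A (\<lambda>x. T x + S x)) (A_numerical_radius A (\<lambda>x. T x - S x))
      \<le> A_euclidean_radius A T S"
  \<comment> \<open>The instance at the identity reads \<open>c * 2 \<le> sqrt 2\<close>.\<close>
  from this[rule_format, OF id_in_A_bounded_ops id_in_A_bounded_ops]
  show "c \<le> sqrt 2 / 2"
    unfolding A_radii_id[OF assms] by simp
next
  fix C :: real
  assume "\<forall>T \<in> A_bounded_ops A. \<forall>S \<in> A_bounded_ops A.
    A_euclidean_radius A T S \<le> C * sqrt ((A_numerical_radius A (\<lambda>x. T x + S x))\<^sup>2
      + (A_numerical_radius A (\<lambda>x. T x - S x))\<^sup>2)"
  \<comment> \<open>Here the instance reads \<open>sqrt 2 \<le> C * sqrt 4\<close>, since the
    difference term vanishes.\<close>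
  from this[rule_format, OF id_in_A_bounded_ops id_in_A_bounded_ops]
  show "sqrt 2 / 2 \<le> C"
    unfolding A_radii_id[OF assms] by simp
qed

end
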